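(* Let $f:\mathbb{R}^n\to\mathbb{R}$ be bounded below by $f^*\in\mathbb{R}$ and differentiable with Lipschitz continuous gradient with constant $L>0$. Let $\epsilon>0$, $\delta_\epsilon=\frac{2\epsilon}{\sqrt{n}(L+2c)}$, and $c_i=\frac{i}{M}c$ for $1\le i\le M-1$. Consider the max-$M$ non-monotone direct search based on a positive spanning set (the algorithm described in the context), and suppose that $\delta_\epsilon\le\delta_0$. Then $$N_{succ,T_\epsilon}\le\frac{f(x_0)-f^*}{\frac{c}{M}\theta^2\delta_\epsilon^2}.$$ Furthermore, $$T_\epsilon\le\frac{\ln\frac{\delta_0\sqrt{n}(L+2c)}{2\theta\epsilon}}{\ln\frac1\theta}+\frac{\ln\frac{\gamma}{\theta}}{\ln\frac1\theta}\cdot\frac{nM(L+2c)^2}{4c\theta^2\epsilon^2}\left(f(x_0)-f^*\right).$$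
   Context: Algorithm (max-$M$ non-monotone direct search based on a positive spanning set). Let $\mathcal{D}\subset\mathbb{R}^n$ be a finite positive spanning set of unit vectors with cosine measure $\min_{v\neq0}\max_{d\in\mathcal{D}}\frac{v^\top d}{\|v\|\|d\|}=\frac1{\sqrt n}$ (e.g. $\{\pm e_1,\dots,\pm e_n\}$). Choose an integer $M>1$, $c>0$, $x_0\in\mathbb{R}^n$, $\delta_0>0$, $\theta\in(0,1)$, $\gamma\in(1,\infty)$. For $k=0,1,\dots$: if there exists $d_k\in\mathcal{D}$ with $$\max\left(f(x_{succ,k}^{M-1}),\ldots,f(x_{succ,k}^{1}),f(x_k)\right)-f(x_k+\delta_kd_k)\ge c\delta_k^2,$$ then set $x_{k+1}=x_k+\delta_kd_k$ for such a $d_k$ and $\delta_{k+1}=\gamma\delta_k$ (iteration $k$ is successful); otherwise set $x_{k+1}=x_k$, $\delta_{k+1}=\theta\delta_k$ (iteration $k$ is not successful). Here $x_{succ,k}^{i}$, $i\ge1$, is the $i$-th latest successful iterate from $x_k$: if $s_1>s_2>\cdots$ are the successful iterations with index $<k$, listed in reverse order, then $x_{succ,k}^i=x_{s_i}$ if $s_i$ exists, and $x_{succ,k}^i=x_0$ otherwise. Equivalently, it is the $i$-th most recent iterate of the sequence of accepted points preceding the current $x_k$. $T_\epsilon=\inf\{k\ge0:\|\nabla f(x_k)\|\le\epsilon\}$ (with $\inf\emptyset=\infty$). $N_{succ,k}$ is the number of successful iterations among iterations $0,\dots,k-1$. The $c_i$ are coefficients of a merit function used in the analysis. *)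

theory Defs
  imports "HOL-Analysis.Analysis"
begin

definition positive_spanning_set :: "'a::real_inner set \<Rightarrow> bool" where
  "positive_spanning_set D \<longleftrightarrow>
     (\<forall>v. \<exists>a. (\<forall>d\<in>D. 0 \<le> a d) \<and> v = (\<Sum>d\<in>D. a d *\<^sub>R d))"

text \<open>
  Intended for finite nonempty sets \<open>D\<close> of nonzero vectors in a nontrivial finite-dimensional
  space.  The infimum is then attained, since the quotient is continuous in \<open>v\<close> and invariant
  under positive scaling of \<open>v\<close>, so that it is the minimum of the usual definition.
\<close>

definition cosine_measure :: "'a::real_inner set \<Rightarrow> real" where
  "cosine_measure D = (INF v\<in>{v. v \<noteq> 0}. MAX d\<in>D. (v \<bullet> d) / (norm v * norm d))"

text \<open>
  Below, \<open>S\<close> is the set of successful iterations and \<open>x\<close> the sequence of iterates.  If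
  \<open>s\<^sub>1 > s\<^sub>2 > \<dots>\<close> are the elements of \<open>S\<close> less than \<open>k\<close>, then \<open>x_succ x S k i\<close> is the
  \<open>i\<close>-th latest successful iterate \<open>x s\<^sub>i\<close>, for \<open>i \<ge> 1\<close>.
\<close>

definition x_succ :: "(nat \<Rightarrow> 'a) \<Rightarrow> nat set \<Rightarrow> nat \<Rightarrow> nat \<Rightarrow> 'a" where
  "x_succ x S k i =
     (let ss = rev (filter (\<lambda>j. j \<in> S) [0..<k])
      in if i - 1 < length ss then x (ss ! (i - 1)) else x 0)"

definition sufficient_decrease ::
  "('a::real_vector \<Rightarrow> real) \<Rightarrow> nat \<Rightarrow> real \<Rightarrow> (nat \<Rightarrow> 'a) \<Rightarrow> (nat \<Rightarrow> real) \<Rightarrow> nat set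
     \<Rightarrow> nat \<Rightarrow> 'a \<Rightarrow> bool" where
  "sufficient_decrease f M c x \<delta> S k d \<longleftrightarrow>
     Max (insert (f (x k)) ((\<lambda>i. f (x_succ x S k i)) ` {1..M - 1}))
       - f (x k + \<delta> k *\<^sub>R d) \<ge> c * (\<delta> k)\<^sup>2"

text \<open>
  The iterates \<open>x\<close>, the step sizes \<open>\<delta>\<close> and the set \<open>S\<close> of successful iterations form a run of
  the method.  Nothing is assumed about how a direction is selected if several are acceptable.
  The first condition in the step determines \<open>S\<close>, because \<open>sufficient_decrease\<close> at \<open>k\<close> depends
  only on the elements of \<open>S\<close> less than \<open>k\<close>.
\<close>

definition max_direct_search ::
  "('a::real_vector \<Rightarrow> real) \<Rightarrow> 'a set \<Rightarrow> nat \<Rightarrow> real \<Rightarrow> 'a \<Rightarrow> real \<Rightarrow> real \<Rightarrow> real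
     \<Rightarrow> (nat \<Rightarrow> 'a) \<Rightarrow> (nat \<Rightarrow> real) \<Rightarrow> nat set \<Rightarrow> bool" where
  "max_direct_search f D M c x\<^sub>0 \<delta>\<^sub>0 \<theta> \<gamma> x \<delta> S \<longleftrightarrow>
     x 0 = x\<^sub>0 \<and> \<delta> 0 = \<delta>\<^sub>0 \<and>
     (\<forall>k. (k \<in> S \<longleftrightarrow> (\<exists>d\<in>D. sufficient_decrease f M c x \<delta> S k d)) \<and>
          (if k \<in> S
           then (\<exists>d\<in>D. sufficient_decrease f M c x \<delta> S k d \<and> x (Suc k) = x k + \<delta> k *\<^sub>R d)
                \<and> \<delta> (Suc k) = \<gamma> * \<delta> k
           else x (Suc k) = x k \<and> \<delta> (Suc k) = \<theta> * \<delta> k))"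

text \<open>The infimum is taken in \<^typ>\<open>enat\<close>, where the infimum of the empty set is \<open>\<infinity>\<close>.\<close>

definition hitting_time :: "('a \<Rightarrow> 'b::real_normed_vector) \<Rightarrow> (nat \<Rightarrow> 'a) \<Rightarrow> real \<Rightarrow> enat" where
  "hitting_time g x \<epsilon> = Inf {enat k |k. norm (g (x k)) \<le> \<epsilon>}"

text \<open>
  The number of successful iterations with index less than \<open>N\<close>, including the case \<open>N = \<infinity>\<close>,
  where there may be infinitely many of them.
\<close>

definition N_succ :: "nat set \<Rightarrow> enat \<Rightarrow> enat" where
  "N_succ S N =
     (let A = {j \<in> S. enat j < N} in if finite A then enat (card A) else \<infinity>)"

end

theory Submission
  imports Defs
begin

text \<open>
  As long as the gradient norm exceeds \<open>\<epsilon>\<close>, the step size, which starts at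
  \<open>\<delta>\<^sub>0 \<ge> \<delta>\<^sub>\<epsilon>\<close>, cannot drop below \<open>\<theta> * \<delta>\<^sub>\<epsilon>\<close>: the cosine measure supplies a direction \<open>d\<close> that makes an
  angle with the negative gradient \<open>-g\<close> of cosine at least \<open>1 / sqrt n\<close>, and the
  quadratic upper bound for functions with Lipschitz gradient turns this into a decrease of at
  least \<open>\<delta> * norm g / sqrt n - L * \<delta>\<^sup>2 / 2\<close> along \<open>d\<close>.  A failed iteration means that
  this is less than \<open>c * \<delta>\<^sup>2\<close>, hence that \<open>\<delta> > \<delta>\<^sub>\<epsilon>\<close> before the reduction by
  \<open>\<theta>\<close> (\<open>step_size_gt_if_no_sufficient_decrease\<close>, \<open>step_size_ge\<close>).

  Consequently each success lowers \<open>f\<close> by at least \<open>e = c * (\<theta> * \<delta>\<^sub>\<epsilon>)\<^sup>2\<close>, but only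
  relative to the worst of the last \<open>M\<close> accepted points.  Every such gain is therefore worth
  at least \<open>e / M\<close> on average: after \<open>N\<close> successes, the accepted point of lag
  \<open>i < M\<close> (where the current iterate has lag zero) has value at most
  \<open>f x\<^sub>0 - (N - i) / M * e\<close>, with the difference \<open>N - i\<close> truncated at zero.  The
  next accepted point is compared with a point of lag at most \<open>M - 1\<close>, and the full gain
  \<open>e = M / M * e\<close> makes up exactly for this lag and one more success
  (\<open>accepted_value_le\<close>).  Since \<open>f\<close> is bounded below, this bounds the number of successes.

  Finally, \<open>s\<close> successes and \<open>u\<close> failures leave the step size
  \<open>\<delta>\<^sub>0 * \<gamma> ^ s * \<theta> ^ u\<close>.  This is still at least \<open>\<theta> * \<delta>\<^sub>\<epsilon>\<close>, so taking
  logarithms bounds \<open>u\<close> in terms of \<open>s\<close>, and thus bounds the total number of iterations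
  (\<open>iterations_le\<close>).  All estimates are made for an arbitrary finite number \<open>K\<close> of
  iterations before the hitting time; that they are uniform in \<open>K\<close> is what makes the hitting
  time finite.
\<close>

section \<open>Decrease along a well-aligned direction\<close>

text \<open>
  Along the segment from \<open>x\<close> to \<open>x + h\<close>, the difference of both sides has a derivative of
  constant sign by the Lipschitz condition, so that no integral of the gradient is needed.
\<close>

lemma lipschitz_gradient_upper_bound:
  fixes f :: "'a::real_inner \<Rightarrow> real"
  assumes grad: "\<And>y. GDERIV f y :> g y"
    and lip: "L-lipschitz_on UNIV g"
  shows "f (x + h) \<le> f x + g x \<bullet> h + L / 2 * (norm h)\<^sup>2"
proof -
  define \<phi> where "\<phi> t = f (x + t *\<^sub>R h) - t * (g x \<bullet> h) - L / 2 * t\<^sup>2 * (norm h)\<^sup>2" for t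
  have deriv: "(\<phi> has_real_derivative
      ((g (x + t *\<^sub>R h) - g x) \<bullet> h - L * t * (norm h)\<^sup>2)) (at t)" for t
  proof -
    have outer: "(f has_derivative (\<lambda>v. v \<bullet> g (x + t *\<^sub>R h))) (at (x + t *\<^sub>R h))"
      using grad by (simp add: gderiv_def)
    have inner: "((\<lambda>t. x + t *\<^sub>R h) has_derivative (\<lambda>s. s *\<^sub>R h)) (at t)"
      by (auto intro!: derivative_eq_intros)
    have "((\<lambda>t. f (x + t *\<^sub>R h)) has_derivative (\<lambda>s. (s *\<^sub>R h) \<bullet> g (x + t *\<^sub>R h))) (at t)"
      using has_derivative_compose[OF inner outer] .
    moreover have "(\<lambda>s. (s *\<^sub>R h) \<bullet> g (x + t *\<^sub>R h)) = (*) (g (x + t *\<^sub>R h) \<bullet> h)"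
      by (auto simp: inner_commute)
    ultimately have "((\<lambda>t. f (x + t *\<^sub>R h)) has_real_derivative g (x + t *\<^sub>R h) \<bullet> h) (at t)"
      by (simp add: has_field_derivative_def)
    then show ?thesis
      unfolding \<phi>_def by (auto intro!: derivative_eq_intros simp: inner_diff_left)
  qed
  have "\<phi> 1 \<le> \<phi> 0"
  proof (rule DERIV_nonpos_imp_nonincreasing[of 0 1 \<phi>])
    fix t :: real
    assume "0 \<le> t" "t \<le> 1"
    have "(g (x + t *\<^sub>R h) - g x) \<bullet> h \<le> norm (g (x + t *\<^sub>R h) - g x) * norm h"
      by (rule norm_cauchy_schwarz)
    also have "\<dots> \<le> L * norm (t *\<^sub>R h) * norm h"
      using lipschitz_onD[OF lip, of "x + t *\<^sub>R h" x]
      by (intro mult_right_mono) (auto simp: dist_norm)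
    also have "\<dots> = L * t * (norm h)\<^sup>2"
      using \<open>0 \<le> t\<close> by (simp add: power2_eq_square)
    finally show "\<exists>y. (\<phi> has_real_derivative y) (at t) \<and> y \<le> 0"
      using deriv[of t] by auto
  qed simp
  then show ?thesis
    by (simp add: \<phi>_def)
qed

text \<open>
  The infimum in the cosine measure bounds the maximum at each vector from below only because
  the maxima are bounded below, here by \<open>-1\<close> by the Cauchy--Schwarz inequality.
\<close>

lemma direction_with_cosine_ge:
  fixes D :: "'a::real_inner set"
  assumes "finite D" "D \<noteq> {}"
    and unit: "\<And>d. d \<in> D \<Longrightarrow> norm d = 1"
  obtains d where "d \<in> D" "cosine_measure D * norm v \<le> v \<bullet> d"
proof (cases "v = 0")
  case True
  then show ?thesis
    using that \<open>D \<noteq> {}\<close> by auto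
next
  case False
  define m where "m u = (MAX d\<in>D. (u \<bullet> d) / (norm u * norm d))" for u
  have bounded: "-1 \<le> m u" if "u \<noteq> 0" for u
  proof -
    obtain d where d: "d \<in> D"
      using \<open>D \<noteq> {}\<close> by blast
    have "- (norm u * norm d) \<le> u \<bullet> d"
      using Cauchy_Schwarz_ineq2[of u d] by linarith
    then have "-1 \<le> (u \<bullet> d) / (norm u * norm d)"
      using that unit[OF d] by (simp add: field_simps)
    also have "\<dots> \<le> m u"
      unfolding m_def using d \<open>finite D\<close> by (intro Max_ge) auto
    finally show ?thesis .
  qed
  have "cosine_measure D \<le> m v"
    unfolding cosine_measure_def m_def[symmetric]
    using False bounded by (intro cINF_lower bdd_belowI2[where m = "-1"]) auto
  moreover have "m v \<in> (\<lambda>d. (v \<bullet> d) / (norm v * norm d)) ` D"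
    unfolding m_def using \<open>finite D\<close> \<open>D \<noteq> {}\<close> by (intro Max_in) auto
  then obtain d where "d \<in> D" "m v = (v \<bullet> d) / norm v"
    using unit by auto
  ultimately show ?thesis
    using that[of d] False by (simp add: field_simps)
qed

lemma positive_spanning_set_nonempty:
  fixes D :: "'a::{real_inner, perfect_space} set"
  assumes "positive_spanning_set D"
  shows "D \<noteq> {}"
proof
  assume "D = {}"
  then have "v = 0" for v :: 'a
    using assms by (auto simp: positive_spanning_set_def)
  then show False
    using UNIV_not_singleton[of "0::'a"] by auto
qed

text \<open>
  The test takes the maximum with \<open>f (x k)\<close> among its arguments, so its failure implies the
  failure of the monotone test, to which the quadratic upper bound applies.
\<close>

lemma step_size_gt_if_no_sufficient_decrease:
  fixes f :: "'a::real_inner \<Rightarrow> real"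
  assumes grad: "\<And>y. GDERIV f y :> g y"
    and lip: "L-lipschitz_on UNIV g"
    and D: "finite D" "D \<noteq> {}" "\<And>d. d \<in> D \<Longrightarrow> norm d = 1"
    and "0 \<le> L" "0 < c" "0 < \<delta> k"
    and fail: "\<And>d. d \<in> D \<Longrightarrow> \<not> sufficient_decrease f M c x \<delta> S k d"
  shows "2 * cosine_measure D * norm (g (x k)) / (L + 2 * c) < \<delta> k"
proof -
  obtain d where d: "d \<in> D" "cosine_measure D * norm (g (x k)) \<le> - g (x k) \<bullet> d"
    using direction_with_cosine_ge[OF D, of "- g (x k)"] by auto
  have "f (x k) \<le> Max (insert (f (x k)) ((\<lambda>i. f (x_succ x S k i)) ` {1..M - 1}))"
    by (intro Max_ge) auto
  then have "f (x k) - f (x k + \<delta> k *\<^sub>R d) < c * (\<delta> k)\<^sup>2"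
    using fail[OF d(1)] unfolding sufficient_decrease_def by linarith
  moreover have "f (x k + \<delta> k *\<^sub>R d) \<le> f (x k) + \<delta> k * (g (x k) \<bullet> d) + L / 2 * (\<delta> k)\<^sup>2"
    using lipschitz_gradient_upper_bound[OF grad lip, of "x k" "\<delta> k *\<^sub>R d"] D(3)[OF d(1)]
    by simp
  moreover have "\<delta> k * (cosine_measure D * norm (g (x k))) \<le> \<delta> k * (- g (x k) \<bullet> d)"
    using d(2) \<open>0 < \<delta> k\<close> by (intro mult_left_mono) auto
  ultimately have "\<delta> k * (cosine_measure D * norm (g (x k))) < \<delta> k * ((L / 2 + c) * \<delta> k)"
    by (simp add: algebra_simps power2_eq_square)
  then have "cosine_measure D * norm (g (x k)) < (L / 2 + c) * \<delta> k"
    using \<open>0 < \<delta> k\<close> by simp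
  then show ?thesis
    using \<open>0 \<le> L\<close> \<open>0 < c\<close> by (simp add: field_simps)
qed

section \<open>Runs of the method\<close>

lemma max_direct_search_start:
  assumes "max_direct_search f D M c x\<^sub>0 \<delta>\<^sub>0 \<theta> \<gamma> x \<delta> S"
  shows "x 0 = x\<^sub>0" "\<delta> 0 = \<delta>\<^sub>0"
  using assms by (auto simp: max_direct_search_def)

lemma max_direct_search_success:
  assumes "max_direct_search f D M c x\<^sub>0 \<delta>\<^sub>0 \<theta> \<gamma> x \<delta> S" "k \<in> S"
  obtains d where "d \<in> D" "sufficient_decrease f M c x \<delta> S k d"
    "x (Suc k) = x k + \<delta> k *\<^sub>R d" "\<delta> (Suc k) = \<gamma> * \<delta> k"
proof -
  have "(\<exists>d\<in>D. sufficient_decrease f M c x \<delta> S k d \<and> x (Suc k) = x k + \<delta> k *\<^sub>R d)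
      \<and> \<delta> (Suc k) = \<gamma> * \<delta> k"
    using assms unfolding max_direct_search_def by (metis (full_types))
  then show ?thesis
    using that by blast
qed

lemma max_direct_search_failure:
  assumes "max_direct_search f D M c x\<^sub>0 \<delta>\<^sub>0 \<theta> \<gamma> x \<delta> S" "k \<notin> S"
  shows "x (Suc k) = x k" "\<delta> (Suc k) = \<theta> * \<delta> k"
    "d \<in> D \<Longrightarrow> \<not> sufficient_decrease f M c x \<delta> S k d"
  using assms unfolding max_direct_search_def by (metis (full_types))+

lemma card_Int_lessThan_Suc:
  "card (S \<inter> {..<Suc k}) = card (S \<inter> {..<k}) + (if k \<in> S then 1 else 0)"
proof (cases "k \<in> S")
  case True
  then have "S \<inter> {..<Suc k} = insert k (S \<inter> {..<k})"
    by auto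
  then show ?thesis
    using True by simp
next
  case False
  then have "S \<inter> {..<Suc k} = S \<inter> {..<k}"
    by (auto simp: less_Suc_eq)
  then show ?thesis
    using False by simp
qed

lemma card_Int_lessThan_le: "card (S \<inter> {..<k}) \<le> k"
  using card_mono[of "{..<k}" "S \<inter> {..<k}"] by simp

lemma step_size_eq:
  assumes run: "max_direct_search f D M c x\<^sub>0 \<delta>\<^sub>0 \<theta> \<gamma> x \<delta> S"
  shows "\<delta> k = \<delta>\<^sub>0 * \<gamma> ^ card (S \<inter> {..<k}) * \<theta> ^ (k - card (S \<inter> {..<k}))"
proof (induction k)
  case 0
  then show ?case
    using max_direct_search_start[OF run] by simp
next
  case (Suc k)
  show ?case
  proof (cases "k \<in> S")
    case True
    then obtain d where "\<delta> (Suc k) = \<gamma> * \<delta> k"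
      using max_direct_search_success[OF run] by metis
    then show ?thesis
      using True Suc by (simp add: card_Int_lessThan_Suc)
  next
    case False
    then show ?thesis
      using Suc max_direct_search_failure(2)[OF run False] card_Int_lessThan_le[of S k]
      by (simp add: card_Int_lessThan_Suc Suc_diff_le)
  qed
qed

text \<open>
  A success only enlarges the step size, so a lower bound \<open>\<eta>\<close> at the failures suffices.  That
  bound may presuppose a positive step size, because positivity is maintained by the induction.
\<close>

lemma step_size_ge:
  fixes f :: "'a::real_inner \<Rightarrow> real"
  assumes run: "max_direct_search f D M c x\<^sub>0 \<delta>\<^sub>0 \<theta> \<gamma> x \<delta> S"
    and fail: "\<And>k. k < K \<Longrightarrow> k \<notin> S \<Longrightarrow> 0 < \<delta> k \<Longrightarrow> \<eta> \<le> \<delta> k"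
    and "0 < \<eta>" "\<eta> \<le> \<delta>\<^sub>0" "0 < \<theta>" "\<theta> \<le> 1" "1 \<le> \<gamma>"
    and "k \<le> K"
  shows "\<theta> * \<eta> \<le> \<delta> k"
  using \<open>k \<le> K\<close>
proof (induction k)
  case 0
  have "\<theta> * \<eta> \<le> 1 * \<delta>\<^sub>0"
    using assms by (intro mult_mono) auto
  then show ?case
    using max_direct_search_start[OF run] by simp
next
  case (Suc k)
  have IH: "\<theta> * \<eta> \<le> \<delta> k"
    using Suc by simp
  moreover have "0 < \<theta> * \<eta>"
    using assms by simp
  ultimately have pos: "0 < \<delta> k"
    by linarith
  show ?case
  proof (cases "k \<in> S")
    case True
    then obtain d where "\<delta> (Suc k) = \<gamma> * \<delta> k"
      using max_direct_search_success[OF run] by metis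
    moreover have "1 * \<delta> k \<le> \<gamma> * \<delta> k"
      using pos \<open>1 \<le> \<gamma>\<close> by (intro mult_right_mono) auto
    ultimately show ?thesis
      using IH by linarith
  next
    case False
    then show ?thesis
      using fail[of k] pos Suc.prems max_direct_search_failure(2)[OF run False] \<open>0 < \<theta>\<close>
      by simp
  qed
qed

section \<open>The number of successes\<close>

text \<open>
  The points compared at iteration \<open>k\<close>: adding the current iterate at lag zero makes the
  update after a success a plain shift of the lag.
\<close>

definition accepted_point :: "(nat \<Rightarrow> 'a) \<Rightarrow> nat set \<Rightarrow> nat \<Rightarrow> nat \<Rightarrow> 'a" where
  "accepted_point x S k i = (if i = 0 then x k else x_succ x S k i)"

lemma accepted_point_0: "accepted_point x S 0 i = x 0"
  by (simp add: accepted_point_def x_succ_def)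

lemma accepted_point_Suc_success:
  assumes "k \<in> S"
  shows "accepted_point x S (Suc k) (Suc i) = accepted_point x S k i"
  using assms by (cases i) (auto simp: accepted_point_def x_succ_def Let_def)

lemma accepted_point_Suc_failure:
  assumes "k \<notin> S" "x (Suc k) = x k"
  shows "accepted_point x S (Suc k) i = accepted_point x S k i"
  using assms by (simp add: accepted_point_def x_succ_def)

lemma sufficient_decrease_accepted_point:
  assumes "sufficient_decrease f M c x \<delta> S k d" "0 < M"
  obtains i where "i < M"
    "f (x k + \<delta> k *\<^sub>R d) \<le> f (accepted_point x S k i) - c * (\<delta> k)\<^sup>2"
proof -
  let ?A = "insert (f (x k)) ((\<lambda>i. f (x_succ x S k i)) ` {1..M - 1})"
  have "Max ?A \<in> ?A"
    by (intro Max_in) auto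
  then obtain i where "i < M" "Max ?A = f (accepted_point x S k i)"
  proof
    assume "Max ?A = f (x k)"
    then show ?thesis
      using that[of 0] \<open>0 < M\<close> by (simp add: accepted_point_def)
  next
    assume "Max ?A \<in> (\<lambda>i. f (x_succ x S k i)) ` {1..M - 1}"
    then obtain i where "i \<in> {1..M - 1}" "Max ?A = f (x_succ x S k i)"
      by blast
    then show ?thesis
      using that[of i] by (auto simp: accepted_point_def simp del: Max_insert)
  qed
  then show ?thesis
    using that[of i] assms(1) unfolding sufficient_decrease_def by simp
qed

text \<open>
  Spreading each gain \<open>e\<close> evenly over \<open>M\<close> successes turns the decrease of a running maximum
  into a bound that is linear in the number of successes, and thus needs no rounding to
  multiples of \<open>M\<close>.
\<close>

lemma accepted_value_le:
  assumes run: "max_direct_search f D M c x\<^sub>0 \<delta>\<^sub>0 \<theta> \<gamma> x \<delta> S"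
    and "0 < M" "0 \<le> e"
    and gain: "\<And>k. k < K \<Longrightarrow> k \<in> S \<Longrightarrow> e \<le> c * (\<delta> k)\<^sup>2"
    and "k \<le> K" "i < M"
  shows "f (accepted_point x S k i) \<le> f x\<^sub>0 - real (card (S \<inter> {..<k}) - i) / real M * e"
  using \<open>k \<le> K\<close> \<open>i < M\<close>
proof (induction k arbitrary: i)
  case 0
  then show ?case
    using max_direct_search_start[OF run] by (simp add: accepted_point_0)
next
  case (Suc k)
  have IH: "f (accepted_point x S k j) \<le> f x\<^sub>0 - real (card (S \<inter> {..<k}) - j) / real M * e"
    if "j < M" for j
    using Suc that by simp
  show ?case
  proof (cases "k \<in> S")
    case False
    then show ?thesis
      using IH[OF Suc.prems(2)] max_direct_search_failure(1)[OF run False]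
      by (simp add: accepted_point_Suc_failure card_Int_lessThan_Suc)
  next
    case True
    show ?thesis
    proof (cases i)
      case (Suc j)
      then show ?thesis
        using IH[of j] Suc.prems True
        by (simp add: accepted_point_Suc_success card_Int_lessThan_Suc)
    next
      case 0
      obtain d where d: "sufficient_decrease f M c x \<delta> S k d" "x (Suc k) = x k + \<delta> k *\<^sub>R d"
        using max_direct_search_success[OF run True] by metis
      obtain j where j: "j < M" "f (x (Suc k)) \<le> f (accepted_point x S k j) - c * (\<delta> k)\<^sup>2"
        using sufficient_decrease_accepted_point[OF d(1) \<open>0 < M\<close>] d(2) by metis
      let ?N = "card (S \<inter> {..<k})"
      have "f (x (Suc k)) \<le> f x\<^sub>0 - real (?N - j) / real M * e - e"
        using j(2) IH[OF j(1)] gain[OF _ True] Suc.prems(1) by simp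
      also have "\<dots> = f x\<^sub>0 - real (?N - j + M) / real M * e"
        using \<open>0 < M\<close> by (simp add: field_simps)
      \<comment> \<open>The gain of \<open>M\<close> units covers the lag \<open>j \<le> M - 1\<close> and the new success.\<close>
      also have "\<dots> \<le> f x\<^sub>0 - real (Suc ?N) / real M * e"
        using j(1) \<open>0 \<le> e\<close>
        by (intro diff_left_mono mult_right_mono divide_right_mono) auto
      finally show ?thesis
        using 0 True by (simp add: accepted_point_def card_Int_lessThan_Suc)
    qed
  qed
qed

lemma successes_le:
  assumes run: "max_direct_search f D M c x\<^sub>0 \<delta>\<^sub>0 \<theta> \<gamma> x \<delta> S"
    and "0 < M" "0 < c" "0 < \<eta>"
    and lower: "\<And>y. f_star \<le> f y"
    and steps: "\<And>k. k < K \<Longrightarrow> k \<in> S \<Longrightarrow> \<eta> \<le> \<delta> k"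
  shows "real (card (S \<inter> {..<K})) \<le> (f x\<^sub>0 - f_star) / (c / real M * \<eta>\<^sup>2)"
proof -
  have "c * \<eta>\<^sup>2 \<le> c * (\<delta> k)\<^sup>2" if "k < K" "k \<in> S" for k
    using steps[OF that] \<open>0 < \<eta>\<close> \<open>0 < c\<close> by (intro mult_left_mono power_mono) auto
  then have "f (accepted_point x S K 0) \<le>
      f x\<^sub>0 - real (card (S \<inter> {..<K}) - 0) / real M * (c * \<eta>\<^sup>2)"
    using \<open>0 < M\<close> \<open>0 < c\<close> by (intro accepted_value_le[OF run, where K = K]) auto
  then have "real (card (S \<inter> {..<K})) / real M * (c * \<eta>\<^sup>2) \<le> f x\<^sub>0 - f_star"
    using lower[of "accepted_point x S K 0"] by simp
  then show ?thesis
    using \<open>0 < M\<close> \<open>0 < c\<close> \<open>0 < \<eta>\<close> by (simp add: pos_le_divide_eq pos_divide_le_eq)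
qed

section \<open>The number of iterations\<close>

lemma iterations_le:
  assumes run: "max_direct_search f D M c x\<^sub>0 \<delta>\<^sub>0 \<theta> \<gamma> x \<delta> S"
    and "0 < \<eta>" "\<eta> \<le> \<delta> K" "0 < \<delta>\<^sub>0" "0 < \<theta>" "\<theta> < 1" "0 < \<gamma>"
  shows "real K \<le> ln (\<delta>\<^sub>0 / \<eta>) / ln (1 / \<theta>)
    + ln (\<gamma> / \<theta>) / ln (1 / \<theta>) * real (card (S \<inter> {..<K}))"
proof -
  define s u where "s = card (S \<inter> {..<K})" and "u = K - s"
  have K: "real K = real s + real u"
    using card_Int_lessThan_le[of S K] by (simp add: s_def u_def)
  have "ln \<eta> \<le> ln (\<delta>\<^sub>0 * \<gamma> ^ s * \<theta> ^ u)"
    using assms step_size_eq[OF run, of K] by (simp add: s_def u_def)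
  also have "\<dots> = ln \<delta>\<^sub>0 + real s * ln \<gamma> + real u * ln \<theta>"
    using assms by (simp add: ln_mult ln_realpow)
  finally have "real K * ln (1 / \<theta>) \<le> ln (\<delta>\<^sub>0 / \<eta>) + ln (\<gamma> / \<theta>) * real s"
    using assms by (simp add: K ln_div algebra_simps)
  moreover have "0 < ln (1 / \<theta>)"
    using assms by simp
  ultimately show ?thesis
    unfolding s_def[symmetric] by (simp add: field_simps)
qed

section \<open>Passing to the hitting time\<close>

lemma norm_gt_if_less_hitting_time:
  assumes "enat k < hitting_time g x \<epsilon>"
  shows "\<epsilon> < norm (g (x k))"
proof (rule ccontr)
  assume "\<not> ?thesis"
  then have "hitting_time g x \<epsilon> \<le> enat k"
    unfolding hitting_time_def by (intro Inf_lower) auto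
  then show False
    using assms by simp
qed

lemma enat_finite_if_bounded:
  assumes "\<And>K. enat K \<le> T \<Longrightarrow> real K \<le> R"
  obtains N where "T = enat N"
proof (cases T)
  case infinity
  obtain K :: nat where "R < real K"
    using reals_Archimedean2 by blast
  then show ?thesis
    using assms[of K] infinity by simp
qed (use that in blast)

lemma N_succ_enat: "N_succ S (enat K) = enat (card (S \<inter> {..<K}))"
proof -
  have "{j \<in> S. enat j < enat K} = S \<inter> {..<K}"
    by auto
  then show ?thesis
    by (simp add: N_succ_def)
qed

theorem theorem3p5:
  fixes f :: "real ^ 'n \<Rightarrow> real"
    and grad_f :: "real ^ 'n \<Rightarrow> real ^ 'n"
    and D :: "(real ^ 'n) set"
    and f_star L \<epsilon> \<delta>\<^sub>\<epsilon> c \<delta>\<^sub>0 \<theta> \<gamma> :: real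
    and n M :: nat
    and coeff :: "nat \<Rightarrow> real"
    and x\<^sub>0 :: "real ^ 'n"
    and x :: "nat \<Rightarrow> real ^ 'n"
    and \<delta> :: "nat \<Rightarrow> real"
    and S :: "nat set"
    and T\<^sub>\<epsilon> :: enat
  assumes n_def: "n = CARD('n)"
    and f_lower: "\<forall>y. f_star \<le> f y"
    and f_grad: "\<forall>y. GDERIV f y :> grad_f y"
    and L_pos: "L > 0"
    and grad_lipschitz: "L-lipschitz_on UNIV grad_f"
    and D_finite: "finite D"
    and D_unit: "\<forall>d\<in>D. norm d = 1"
    and D_spanning: "positive_spanning_set D"
    and D_cosine: "cosine_measure D = 1 / sqrt (real n)"
    and M_gt: "M > 1"
    and c_pos: "c > 0"
    and \<delta>\<^sub>0_pos: "\<delta>\<^sub>0 > 0"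
    and \<theta>_bounds: "0 < \<theta>" "\<theta> < 1"
    and \<gamma>_gt: "\<gamma> > 1"
    and run: "max_direct_search f D M c x\<^sub>0 \<delta>\<^sub>0 \<theta> \<gamma> x \<delta> S"
    and \<epsilon>_pos: "\<epsilon> > 0"
    and \<delta>\<^sub>\<epsilon>_def: "\<delta>\<^sub>\<epsilon> = 2 * \<epsilon> / (sqrt (real n) * (L + 2 * c))"
    and coeff_def: "\<forall>i\<in>{1..M - 1}. coeff i = real i / real M * c"
    and \<delta>\<^sub>\<epsilon>_le: "\<delta>\<^sub>\<epsilon> \<le> \<delta>\<^sub>0"
    and T\<^sub>\<epsilon>_def: "T\<^sub>\<epsilon> = hitting_time grad_f x \<epsilon>"
  shows "ereal_of_enat (N_succ S T\<^sub>\<epsilon>)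
           \<le> ereal ((f x\<^sub>0 - f_star) / (c / real M * \<theta>\<^sup>2 * \<delta>\<^sub>\<epsilon>\<^sup>2))
         \<and> ereal_of_enat T\<^sub>\<epsilon>
           \<le> ereal (ln (\<delta>\<^sub>0 * sqrt (real n) * (L + 2 * c) / (2 * \<theta> * \<epsilon>)) / ln (1 / \<theta>)
                    + ln (\<gamma> / \<theta>) / ln (1 / \<theta>)
                      * (real n * real M * (L + 2 * c)\<^sup>2 / (4 * c * \<theta>\<^sup>2 * \<epsilon>\<^sup>2))
                      * (f x\<^sub>0 - f_star))"
proof -
  have n_pos: "0 < real n"
    using n_def by simp
  have pos: "0 < L + 2 * c" "0 < \<delta>\<^sub>\<epsilon>"
    using L_pos c_pos \<epsilon>_pos n_pos by (simp_all add: \<delta>\<^sub>\<epsilon>_def)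
  have D_nonempty: "D \<noteq> {}"
    using D_spanning by (rule positive_spanning_set_nonempty)
  define B where "B = (f x\<^sub>0 - f_star) / (c / real M * \<theta>\<^sup>2 * \<delta>\<^sub>\<epsilon>\<^sup>2)"
  define R where "R = ln (\<delta>\<^sub>0 * sqrt (real n) * (L + 2 * c) / (2 * \<theta> * \<epsilon>)) / ln (1 / \<theta>)
                    + ln (\<gamma> / \<theta>) / ln (1 / \<theta>)
                      * (real n * real M * (L + 2 * c)\<^sup>2 / (4 * c * \<theta>\<^sup>2 * \<epsilon>\<^sup>2))
                      * (f x\<^sub>0 - f_star)"
  have failed_step: "\<delta>\<^sub>\<epsilon> \<le> \<delta> k" if "enat k < T\<^sub>\<epsilon>" "k \<notin> S" "0 < \<delta> k" for k
  proof -
    have "\<delta>\<^sub>\<epsilon> = 2 * cosine_measure D * \<epsilon> / (L + 2 * c)"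
      by (simp add: \<delta>\<^sub>\<epsilon>_def D_cosine)
    also have "\<dots> \<le> 2 * cosine_measure D * norm (grad_f (x k)) / (L + 2 * c)"
      using norm_gt_if_less_hitting_time[of k grad_f x \<epsilon>] that(1) pos
      by (intro divide_right_mono mult_left_mono) (auto simp: T\<^sub>\<epsilon>_def D_cosine)
    also have "\<dots> < \<delta> k"
      using f_grad D_unit L_pos c_pos that(3) max_direct_search_failure(3)[OF run that(2)]
      by (intro step_size_gt_if_no_sufficient_decrease[OF _ grad_lipschitz D_finite D_nonempty])
        auto
    finally show ?thesis
      by simp
  qed
  have successes: "real (card (S \<inter> {..<K})) \<le> B" and iterations: "real K \<le> R"
    if "enat K \<le> T\<^sub>\<epsilon>" for K
  proof -
    have "enat k < T\<^sub>\<epsilon>" if "k < K" for k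
      using that \<open>enat K \<le> T\<^sub>\<epsilon>\<close> by (metis enat_ord_simps(2) less_le_trans)
    then have steps: "\<theta> * \<delta>\<^sub>\<epsilon> \<le> \<delta> k" if "k \<le> K" for k
      using that failed_step pos \<delta>\<^sub>\<epsilon>_le \<theta>_bounds \<gamma>_gt
      by (intro step_size_ge[OF run, of K]) auto
    have "real (card (S \<inter> {..<K})) \<le> (f x\<^sub>0 - f_star) / (c / real M * (\<theta> * \<delta>\<^sub>\<epsilon>)\<^sup>2)"
      using M_gt c_pos \<theta>_bounds pos f_lower steps by (intro successes_le[OF run]) auto
    then show card: "real (card (S \<inter> {..<K})) \<le> B"
      by (simp add: B_def power_mult_distrib mult.assoc)
    have "real K \<le> ln (\<delta>\<^sub>0 / (\<theta> * \<delta>\<^sub>\<epsilon>)) / ln (1 / \<theta>)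
        + ln (\<gamma> / \<theta>) / ln (1 / \<theta>) * real (card (S \<inter> {..<K}))"
      using steps[of K] pos \<delta>\<^sub>0_pos \<theta>_bounds \<gamma>_gt by (intro iterations_le[OF run]) auto
    also have "\<dots> \<le> ln (\<delta>\<^sub>0 / (\<theta> * \<delta>\<^sub>\<epsilon>)) / ln (1 / \<theta>)
        + ln (\<gamma> / \<theta>) / ln (1 / \<theta>) * B"
      using card \<theta>_bounds \<gamma>_gt
      by (intro add_left_mono mult_left_mono divide_nonneg_nonneg ln_ge_zero) auto
    also have "\<dots> = R"
    proof -
      have "\<delta>\<^sub>0 / (\<theta> * \<delta>\<^sub>\<epsilon>) = \<delta>\<^sub>0 * sqrt (real n) * (L + 2 * c) / (2 * \<theta> * \<epsilon>)"
        by (simp add: \<delta>\<^sub>\<epsilon>_def)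
      moreover have "\<delta>\<^sub>\<epsilon>\<^sup>2 = 4 * \<epsilon>\<^sup>2 / (real n * (L + 2 * c)\<^sup>2)"
        by (simp add: \<delta>\<^sub>\<epsilon>_def power_divide power_mult_distrib)
      then have "B = real n * real M * (L + 2 * c)\<^sup>2 / (4 * c * \<theta>\<^sup>2 * \<epsilon>\<^sup>2) * (f x\<^sub>0 - f_star)"
        by (simp add: B_def ac_simps)
      ultimately show ?thesis
        by (simp add: R_def)
    qed
    finally show "real K \<le> R" .
  qed
  obtain N where "T\<^sub>\<epsilon> = enat N"
    using enat_finite_if_bounded[OF iterations] by blast
  then show ?thesis
    using successes[of N] iterations[of N]
    by (simp only: N_succ_enat B_def[symmetric] R_def[symmetric] ereal_of_enat_simps
        ereal_less_eq(3))
qed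

end
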